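(* Let $]a,b[\subset]0,\pi[$ be an open subinterval with $a>\frac{\pi}{2}$. Then there exist a smooth Riemannian metric $g=c(x)\,dx^2$ on $]0,\pi[$ and two eigenfunctions $u_1$ of $\frac{d^2}{dx^2}$ and $u_2$ of $\Delta_g$ on $]0,\pi[$ (with $u_1,u_2\in H^1_0(]0,\pi[)$), both associated with the eigenvalue $1$, i.e. $u_1''=-u_1$ and $\Delta_gu_2=-u_2$, such that $u_1+u_2=0$ in $]a,b[$ and $u_1+u_2\not\equiv0$ in $]0,\pi[$.
   Context: For a smooth metric $g=c(x)\,dx^2$ ($c>0$ smooth) in dimension 1, the Laplace–Beltrami operator is $\Delta_g=\frac{1}{\sqrt{c}}\frac{d}{dx}\Big(\sqrt{c}\,c^{-1}\frac{d}{dx}\Big)=\frac1c\frac{d^2}{dx^2}-\frac{c'}{2c^2}\frac{d}{dx}$. *)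

theory Defs
  imports "HOL-Analysis.Analysis"
begin

text \<open>
  All functions are total on the reals; only their values on the open set under
  consideration matter.  Smoothness is meant for open sets, where \<^const>\<open>deriv\<close>
  is determined by the restriction of the function.
\<close>

definition smooth_on :: "real set \<Rightarrow> (real \<Rightarrow> real) \<Rightarrow> bool" where
  "smooth_on S f \<longleftrightarrow> (\<forall>n. \<forall>x\<in>S. (deriv ^^ n) f differentiable (at x))"

definition riemannian_metric_on :: "real set \<Rightarrow> (real \<Rightarrow> real) \<Rightarrow> bool" where
  "riemannian_metric_on S c \<longleftrightarrow> smooth_on S c \<and> (\<forall>x\<in>S. 0 < c x)"

definition laplace_beltrami :: "(real \<Rightarrow> real) \<Rightarrow> (real \<Rightarrow> real) \<Rightarrow> real \<Rightarrow> real" where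
  "laplace_beltrami c u x =
     1 / sqrt (c x) * deriv (\<lambda>y. sqrt (c y) * inverse (c y) * deriv u y) x"

lemma laplace_beltrami_expand:
  assumes S: "open S" and c: "riemannian_metric_on S c" and u: "smooth_on S u" and x: "x \<in> S"
  shows "laplace_beltrami c u x =
           1 / c x * deriv (deriv u) x - deriv c x / (2 * (c x)\<^sup>2) * deriv u x"
proof -
  have pos: "0 < c x" using c x by (auto simp: riemannian_metric_on_def)
  have "(deriv ^^ 0) c differentiable (at x)" "(deriv ^^ 1) u differentiable (at x)"
    using c u x unfolding riemannian_metric_on_def smooth_on_def by blast+
  then have dc: "(c has_real_derivative deriv c x) (at x)"
    and du: "(deriv u has_real_derivative deriv (deriv u) x) (at x)"
    by (auto simp: real_differentiable_def DERIV_imp_deriv)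
  define s where "s = sqrt (c x)"
  have s: "s > 0" "c x = s\<^sup>2" using pos by (auto simp: s_def)
  have "((\<lambda>y. sqrt (c y) * inverse (c y) * deriv u y) has_real_derivative
      (deriv c x * (inverse (sqrt (c x)) / 2) * inverse (c x)
        + - (inverse (c x) * deriv c x * inverse (c x)) * sqrt (c x)) * deriv u x
      + deriv (deriv u) x * (sqrt (c x) * inverse (c x))) (at x)"
    using pos by (auto intro!: derivative_eq_intros dc du simp: algebra_simps)
  from DERIV_imp_deriv[OF this] show ?thesis
    using s unfolding laplace_beltrami_def s_def[symmetric] 
    by (simp add: field_simps power2_eq_square)
qed

definition test_functions :: "real set \<Rightarrow> (real \<Rightarrow> real) set" where
  "test_functions S =
     {\<phi>. smooth_on UNIV \<phi> \<and> (\<exists>K. compact K \<and> K \<subseteq> S \<and> (\<forall>x. x \<notin> K \<longrightarrow> \<phi> x = 0))}"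

definition L2_on :: "real set \<Rightarrow> (real \<Rightarrow> real) set" where
  "L2_on S = {f. f \<in> borel_measurable (lebesgue_on S) \<and>
                 integrable (lebesgue_on S) (\<lambda>x. (f x)\<^sup>2)}"

definition weak_deriv_on :: "real set \<Rightarrow> (real \<Rightarrow> real) \<Rightarrow> (real \<Rightarrow> real) \<Rightarrow> bool" where
  "weak_deriv_on S u v \<longleftrightarrow>
     (\<forall>\<phi>\<in>test_functions S.
        (\<integral>x. u x * deriv \<phi> x \<partial>lebesgue_on S) = - (\<integral>x. v x * \<phi> x \<partial>lebesgue_on S))"

text \<open>
  The closure of the test functions in $H^1(S)$.  An element of $H^1(S)$ is a function
  \<open>u\<close> in $L^2(S)$ with a weak derivative \<open>v\<close> in $L^2(S)$; \<open>v\<close> is unique almost everywhere,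
  so the existential quantifier involves no choice.
\<close>

definition H1_0 :: "real set \<Rightarrow> (real \<Rightarrow> real) set" where
  "H1_0 S =
     {u. u \<in> L2_on S \<and>
         (\<exists>v. v \<in> L2_on S \<and> weak_deriv_on S u v \<and>
            (\<exists>\<phi>. (\<forall>n::nat. \<phi> n \<in> test_functions S) \<and>
               (\<lambda>n. (\<integral>x. (\<phi> n x - u x)\<^sup>2 \<partial>lebesgue_on S)
                   + (\<integral>x. (deriv (\<phi> n) x - v x)\<^sup>2 \<partial>lebesgue_on S)) \<longlonglongrightarrow> 0))}"

text \<open>
  Sign convention: the eigenvalue \<open>\<mu>\<close> is that of \<open>- L\<close>, that is \<open>L u = - \<mu> u\<close>.
\<close>

definition eigenfunction_on ::
  "real set \<Rightarrow> ((real \<Rightarrow> real) \<Rightarrow> real \<Rightarrow> real) \<Rightarrow> real \<Rightarrow> (real \<Rightarrow> real) \<Rightarrow> bool" where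
  "eigenfunction_on S L \<mu> u \<longleftrightarrow>
     smooth_on S u \<and> (\<exists>x\<in>S. u x \<noteq> 0) \<and> (\<forall>x\<in>S. L u x = - \<mu> * u x)"

end

theory Submission
  imports Defs "HOL-Real_Asymp.Real_Asymp"
begin

text \<open>
  In the arc length coordinate \<open>s\<close>, \<open>s' = sqrt c\<close>, the equation \<open>\<Delta> u = - u\<close> becomes
  \<open>u'' = - u\<close>, so \<open>sin \<circ> s\<close> is an eigenfunction.  Take for \<open>s\<close> a diffeomorphism of \<open>[0, \<pi>]\<close>
  fixing the end points which is the identity exactly on \<open>[\<pi>/2, \<pi>]\<close> and at \<open>0\<close>, and set
  \<open>u\<^sub>1 = sin\<close>, \<open>u\<^sub>2 = - sin \<circ> s\<close>.  Membership in \<open>H\<^sup>1\<^sub>0\<close> is obtained by multiplying with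
  smooth cut-offs at scale \<open>1/n\<close> near the end points: since \<open>u\<close> vanishes
  linearly there, the gradients \<open>O(n)\<close> of the cut-offs contribute bounded terms.
\<close>

section \<open>Smooth functions\<close>

inductive_set fun_alg :: "(real \<Rightarrow> real) set \<Rightarrow> (real \<Rightarrow> real) set" for G where
  gen: "g \<in> G \<Longrightarrow> g \<in> fun_alg G"
| const: "(\<lambda>x. c) \<in> fun_alg G"
| add: "f \<in> fun_alg G \<Longrightarrow> g \<in> fun_alg G \<Longrightarrow> (\<lambda>x. f x + g x) \<in> fun_alg G"
| mult: "f \<in> fun_alg G \<Longrightarrow> g \<in> fun_alg G \<Longrightarrow> (\<lambda>x. f x * g x) \<in> fun_alg G"

text \<open>By linearity and the Leibniz rule, differentiation maps the whole algebra into itself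
  once it maps the generators into it. Hence every iterate of \<open>deriv\<close> stays in the
  algebra, whose members are all differentiable, and no formula for higher derivatives is
  needed.\<close>

lemma fun_alg_smooth:
  assumes G: "\<And>g. g \<in> G \<Longrightarrow> \<exists>g'\<in>fun_alg G. \<forall>x. (g has_real_derivative g' x) (at x)"
    and f: "f \<in> fun_alg G"
  shows "smooth_on UNIV f"
proof -
  have D: "\<exists>f'\<in>fun_alg G. \<forall>x. (f has_real_derivative f' x) (at x)" if "f \<in> fun_alg G" for f
    using that
  proof induction
    case (gen g)
    then show ?case by (rule G)
  next
    case (const c)
    show ?case
      by (rule bexI[of _ "\<lambda>x. 0"]) (auto intro: fun_alg.const)
  next
    case (add f g)
    then obtain f' g' where "f' \<in> fun_alg G" "g' \<in> fun_alg G"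
      "\<And>x. (f has_real_derivative f' x) (at x)" "\<And>x. (g has_real_derivative g' x) (at x)"
      by blast
    then show ?case
      by (intro bexI[of _ "\<lambda>x. f' x + g' x"]) (auto intro: fun_alg.add DERIV_add)
  next
    case (mult f g)
    then obtain f' g' where "f' \<in> fun_alg G" "g' \<in> fun_alg G"
      "\<And>x. (f has_real_derivative f' x) (at x)" "\<And>x. (g has_real_derivative g' x) (at x)"
      by blast
    with mult show ?case
      by (intro bexI[of _ "\<lambda>x. f' x * g x + g' x * f x"])
        (auto intro: fun_alg.add fun_alg.mult DERIV_mult)
  qed
  have iter: "(deriv ^^ n) f \<in> fun_alg G" for n
  proof (induction n)
    case (Suc n)
    then obtain f' where f': "f' \<in> fun_alg G"
      "\<And>x. ((deriv ^^ n) f has_real_derivative f' x) (at x)"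
      using D by blast
    \<comment> \<open>An equality of functions, available because the derivative is known at every
      real point and not only on an open set.\<close>
    then have "(deriv ^^ Suc n) f = f'"
      by (auto intro!: ext DERIV_imp_deriv)
    with f' show ?case by simp
  qed (use f in simp)
  show ?thesis
    unfolding smooth_on_def real_differentiable_def using D[OF iter] by blast
qed

lemma smooth_on_subset: "smooth_on T f \<Longrightarrow> S \<subseteq> T \<Longrightarrow> smooth_on S f"
  by (auto simp: smooth_on_def)

lemma smooth_on_deriv: "smooth_on S f \<Longrightarrow> smooth_on S (deriv f)"
  unfolding smooth_on_def by (metis comp_apply funpow_Suc_right)

lemma smooth_on_DERIV:
  assumes "smooth_on S f" "x \<in> S"
  shows "(f has_real_derivative deriv f x) (at x)"
proof -
  have "(deriv ^^ 0) f differentiable (at x)"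
    using assms unfolding smooth_on_def by blast
  then show ?thesis
    by (auto simp: real_differentiable_def DERIV_imp_deriv)
qed

lemma smooth_continuous_on:
  assumes "smooth_on UNIV f"
  shows "continuous_on A f"
  by (rule DERIV_continuous_on[of _ _ "deriv f"])
    (use smooth_on_DERIV[OF assms] in \<open>auto intro: has_field_derivative_at_within\<close>)

text \<open>With all smooth functions as generators, the derivative of a generator is again a
  generator. Closure under sums and products follows at once.\<close>

lemma fun_alg_smooth_generators:
  assumes "f \<in> fun_alg {g. smooth_on UNIV g}"
  shows "smooth_on UNIV f"
  using _ assms
proof (rule fun_alg_smooth)
  fix g assume "g \<in> {g. smooth_on UNIV g}"
  then show "\<exists>g'\<in>fun_alg {g. smooth_on UNIV g}. \<forall>x. (g has_real_derivative g' x) (at x)"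
    by (intro bexI[of _ "deriv g"]) (auto intro: smooth_on_DERIV smooth_on_deriv fun_alg.gen)
qed

lemma smooth_const: "smooth_on UNIV (\<lambda>x. c)"
  by (intro fun_alg_smooth_generators fun_alg.const)

lemma smooth_add: "smooth_on UNIV f \<Longrightarrow> smooth_on UNIV g \<Longrightarrow> smooth_on UNIV (\<lambda>x. f x + g x)"
  by (intro fun_alg_smooth_generators fun_alg.add fun_alg.gen) auto

lemma smooth_mult: "smooth_on UNIV f \<Longrightarrow> smooth_on UNIV g \<Longrightarrow> smooth_on UNIV (\<lambda>x. f x * g x)"
  by (intro fun_alg_smooth_generators fun_alg.mult fun_alg.gen) auto

lemma smooth_affine: "smooth_on UNIV (\<lambda>x. p * x + q)"
proof (rule fun_alg_smooth[of "{\<lambda>x. x}"])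
  show "(\<lambda>x. p * x + q) \<in> fun_alg {\<lambda>x. x}"
    by (intro fun_alg.add fun_alg.mult fun_alg.const fun_alg.gen) auto
qed (auto intro!: fun_alg.const bexI[of _ "\<lambda>x. 1"])

text \<open>The generators are the smooth functions together with all pullbacks
  \<open>k \<circ> f\<close> of smooth \<open>k\<close>. By the chain rule the derivative of such a
  pullback is a product of two generators; \<open>k\<close> has to vary because each differentiation
  replaces it by its derivative.\<close>

lemma smooth_compose:
  assumes g: "smooth_on UNIV g" and f: "smooth_on UNIV f"
  shows "smooth_on UNIV (\<lambda>x. g (f x))"
proof -
  let ?G = "{h. smooth_on UNIV h} \<union> {\<lambda>x. g (f x) | g. smooth_on UNIV g}"
  show ?thesis
  proof (rule fun_alg_smooth[of ?G])
    show "(\<lambda>x. g (f x)) \<in> fun_alg ?G"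
      using g by (intro fun_alg.gen) auto
    fix h assume "h \<in> ?G"
    then consider "smooth_on UNIV h" | k where "smooth_on UNIV k" "h = (\<lambda>x. k (f x))"
      by blast
    then show "\<exists>h'\<in>fun_alg ?G. \<forall>x. (h has_real_derivative h' x) (at x)"
    proof cases
      case 1
      then show ?thesis
        by (intro bexI[of _ "deriv h"]) (auto intro: smooth_on_DERIV smooth_on_deriv fun_alg.gen)
    next
      case 2
      have "(\<lambda>x. deriv k (f x)) \<in> ?G" "deriv f \<in> ?G"
        using smooth_on_deriv[OF 2(1)] smooth_on_deriv[OF f] by auto
      then have "(\<lambda>x. deriv k (f x) * deriv f x) \<in> fun_alg ?G"
        by (intro fun_alg.mult fun_alg.gen)
      moreover have "\<forall>x. (h has_real_derivative deriv k (f x) * deriv f x) (at x)"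
        unfolding 2(2) using smooth_on_DERIV[OF 2(1)] smooth_on_DERIV[OF f]
        by (intro allI DERIV_chain2) auto
      ultimately show ?thesis
        by (intro bexI[of _ "\<lambda>x. deriv k (f x) * deriv f x"])
    qed
  qed
qed

lemma smooth_sin: "smooth_on UNIV (sin :: real \<Rightarrow> real)"
proof (rule fun_alg_smooth[of "{sin, cos}"])
  fix g :: "real \<Rightarrow> real" assume "g \<in> {sin, cos}"
  then consider "g = sin" | "g = cos" by blast
  then show "\<exists>g'\<in>fun_alg {sin, cos}. \<forall>x. (g has_real_derivative g' x) (at x)"
  proof cases
    case 1
    then show ?thesis
      by (auto intro: fun_alg.gen intro!: bexI[of _ cos])
  next
    case 2
    have "(\<lambda>x. (-1) * sin x) \<in> fun_alg {sin, cos :: real \<Rightarrow> real}"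
      by (intro fun_alg.mult fun_alg.const fun_alg.gen) auto
    with 2 show ?thesis
      by (intro bexI[of _ "\<lambda>x. (-1) * sin x"]) (auto intro!: derivative_eq_intros)
  qed
qed (auto intro: fun_alg.gen)

section \<open>Flat functions\<close>

text \<open>\<open>flat 0\<close> is the classical smooth function exp(-1/x), extended by zero to
  the left. The powers of 1/x are the factors that its derivatives produce.\<close>

definition flat :: "nat \<Rightarrow> real \<Rightarrow> real" where
  "flat k x = (if x > 0 then inverse x ^ k * exp (- inverse x) else 0)"

lemma flat_nonneg: "0 \<le> flat k x"
  by (simp add: flat_def)

lemma flat_0_le_1: "flat 0 x \<le> 1"
  by (simp add: flat_def)

text \<open>Away from 0 this is a computation. At 0 the exponential beats every power of 1/x, so the
  difference quotient tends to 0 from the right, and it vanishes identically on the left.\<close>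

lemma DERIV_flat:
  "(flat k has_real_derivative flat (k + 2) x - k * flat (k + 1) x) (at x)"
proof -
  consider "x > 0" | "x < 0" | "x = 0" by linarith
  then show ?thesis
  proof cases
    case 1
    \<comment> \<open>Removes the truncated exponent of the power rule; for \<open>k = 0\<close>
      both sides vanish through the factor \<open>real k\<close>.\<close>
    have pow: "real k * inverse x ^ (k - Suc 0) = real k * inverse x ^ k * x"
      using 1 by (cases k) auto
    have "((\<lambda>x. inverse x ^ k * exp (- inverse x)) has_real_derivative
            real k * inverse x ^ (k - Suc 0) * - (inverse x * inverse x) * exp (- inverse x)
              + inverse x ^ k * (exp (- inverse x) * (inverse x * inverse x))) (at x)"
      using 1 by (auto intro!: derivative_eq_intros)
    also have "real k * inverse x ^ (k - Suc 0) * - (inverse x * inverse x) * exp (- inverse x)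
              + inverse x ^ k * (exp (- inverse x) * (inverse x * inverse x))
            = flat (k + 2) x - k * flat (k + 1) x"
      unfolding pow using 1 by (simp add: flat_def field_simps power2_eq_square)
    finally have "((\<lambda>x. inverse x ^ k * exp (- inverse x)) has_real_derivative
            flat (k + 2) x - k * flat (k + 1) x) (at x)" .
    then show ?thesis
      by (rule has_field_derivative_transform_within_open[where S = "{0<..}"])
        (use 1 in \<open>auto simp: flat_def\<close>)
  next
    case 2
    have "((\<lambda>x. 0) has_real_derivative 0) (at x)" by simp
    then have "(flat k has_real_derivative 0) (at x)"
      by (rule has_field_derivative_transform_within_open[where S = "{..<0}"])
        (use 2 in \<open>auto simp: flat_def\<close>)
    with 2 show ?thesis by (simp add: flat_def)
  next
    case 3
    have "((\<lambda>h. flat k h / h) \<longlongrightarrow> 0) (at 0)"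
    proof (rule filterlim_split_at)
      have "((\<lambda>h::real. inverse h ^ k * exp (- inverse h) / h) \<longlongrightarrow> 0) (at_right 0)"
        by real_asymp
      then show "((\<lambda>h. flat k h / h) \<longlongrightarrow> 0) (at_right 0)"
        by (rule Lim_transform_eventually)
          (auto simp: flat_def eventually_at_filter)
      show "((\<lambda>h. flat k h / h) \<longlongrightarrow> 0) (at_left 0)"
        by (rule Lim_transform_eventually[OF tendsto_const])
          (auto simp: flat_def eventually_at_filter)
    qed
    then show ?thesis
      using 3 by (simp add: flat_def DERIV_def)
  qed
qed

lemma DERIV_flat_0: "(flat 0 has_real_derivative flat 2 x) (at x)"
  using DERIV_flat[of 0 x] by (simp add: numeral_2_eq_2)

text \<open>The whole family serves as generators, since the derivative of one member is a
  combination of the next two.\<close>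

lemma smooth_flat: "smooth_on UNIV (flat k)"
proof (rule fun_alg_smooth[of "range flat"])
  fix g assume "g \<in> range flat"
  then obtain k where g: "g = flat k" by auto
  have "(\<lambda>x. flat (k + 2) x + (- real k) * flat (k + 1) x) \<in> fun_alg (range flat)"
    by (intro fun_alg.intros) auto
  moreover have "\<forall>x. (g has_real_derivative flat (k + 2) x + (- real k) * flat (k + 1) x) (at x)"
    using DERIV_flat[of k] by (simp add: g)
  ultimately show "\<exists>g'\<in>fun_alg (range flat). \<forall>x. (g has_real_derivative g' x) (at x)"
    by (intro bexI[of _ "\<lambda>x. flat (k + 2) x + (- real k) * flat (k + 1) x"])
qed (auto intro: fun_alg.gen)

text \<open>Here \<open>t\<close> stands for the rescaled distance to an end point, so this bounds
  distance times cut-off gradient independently of the scale. With y = 1/(t - 1) the quantity is (y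
  + y^2) exp(-y), controlled by the quadratic Taylor bound for exp.\<close>

lemma flat_2_weighted_bound: "\<bar>t * flat 2 (t - 1)\<bar> \<le> 3"
proof (cases "t > 1")
  case True
  define y where "y = inverse (t - 1)"
  have y: "y > 0" "t = 1 + inverse y" using True by (auto simp: y_def)
  have "1 + y + y\<^sup>2 / 2 \<le> exp y"
    using y by (intro exp_lower_Taylor_quadratic) auto
  then have "y + y\<^sup>2 \<le> 3 * exp y"
    using y zero_le_power2[of y] by linarith
  then have "(y + y\<^sup>2) * exp (- y) \<le> 3"
    by (simp add: exp_minus field_simps)
  moreover have "t * flat 2 (t - 1) = (y + y\<^sup>2) * exp (- y)"
    using True y(1) unfolding flat_def y_def[symmetric] y(2)
    by (simp add: field_simps power2_eq_square)
  ultimately show ?thesis using y by simp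
qed (simp add: flat_def)

text \<open>\<open>flat 2 (t - 1)\<close> is of order 1/t^2, which beats the weight
  \<open>t\<close>. This makes the gradient terms of the cut-offs vanish in the limit at each fixed
  interior point.\<close>

lemma flat_2_weighted_tendsto: "((\<lambda>t. t * flat 2 (t - 1)) \<longlongrightarrow> 0) at_top"
proof -
  have "((\<lambda>t::real. t * (inverse (t - 1) ^ 2 * exp (- inverse (t - 1)))) \<longlongrightarrow> 0) at_top"
    by real_asymp
  then show ?thesis
    by (rule Lim_transform_eventually)
      (use eventually_gt_at_top[of 1] in \<open>eventually_elim, simp add: flat_def\<close>)
qed

lemma flat_0_tendsto: "(flat 0 \<longlongrightarrow> 1) at_top"
proof -
  have "((\<lambda>t::real. exp (- inverse t)) \<longlongrightarrow> 1) at_top"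
    by real_asymp
  then show ?thesis
    by (rule Lim_transform_eventually)
      (use eventually_gt_at_top[of 0] in \<open>eventually_elim, simp add: flat_def\<close>)
qed

section \<open>Membership in the Sobolev space\<close>

text \<open>Dominated convergence, with a constant majorant that is integrable because the measure
  is finite.\<close>

lemma bounded_integrals_tendsto_0:
  assumes "finite_measure M"
    and "\<And>n. g n \<in> borel_measurable M"
    and "\<And>n x. x \<in> space M \<Longrightarrow> \<bar>g n x\<bar> \<le> (C::real)"
    and "\<And>x. x \<in> space M \<Longrightarrow> (\<lambda>n. g n x) \<longlonglongrightarrow> 0"
  shows "(\<lambda>n. \<integral>x. (g n x)\<^sup>2 \<partial>M) \<longlonglongrightarrow> 0"
proof -
  interpret finite_measure M by fact
  have "(\<lambda>n. \<integral>x. (g n x)\<^sup>2 \<partial>M) \<longlonglongrightarrow> (\<integral>x. 0 \<partial>M)"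
  proof (rule integral_dominated_convergence[where w = "\<lambda>x. C\<^sup>2"])
    show "AE x in M. (\<lambda>n. (g n x)\<^sup>2) \<longlonglongrightarrow> 0"
      using assms(4) by (intro AE_I2) (auto intro: tendsto_eq_intros)
    show "AE x in M. norm ((g n x)\<^sup>2) \<le> C\<^sup>2" for n
      using assms(3) by (intro AE_I2) (auto simp: abs_le_square_iff[symmetric] intro: order_trans[OF _ abs_ge_self])
  qed (use assms(2) in auto)
  then show ?thesis by simp
qed

text \<open>The mean value inequality from the zero \<open>z\<close>. The factor
  \<open>\<bar>x - z\<bar>\<close> is what absorbs the large gradient of a cut-off near
  \<open>z\<close>.\<close>

lemma vanishing_linear_bound:
  fixes u :: "real \<Rightarrow> real"
  assumes u: "smooth_on UNIV u" and z: "u z = 0" "z \<in> {\<alpha>..\<beta>}" and x: "x \<in> {\<alpha>..\<beta>}"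
    and M: "\<And>y. y \<in> {\<alpha>..\<beta>} \<Longrightarrow> \<bar>deriv u y\<bar> \<le> M"
  shows "\<bar>u x\<bar> \<le> M * \<bar>x - z\<bar>"
proof -
  have "norm (u x - u z) \<le> M * norm (x - z)"
    by (rule field_differentiable_bound[where S = "{\<alpha>..\<beta>}" and f' = "deriv u"])
      (use M x z smooth_on_DERIV[OF u] in \<open>auto intro: has_field_derivative_at_within\<close>)
  then show ?thesis using z by simp
qed

text \<open>The approximants are u \<eta> with cut-offs \<eta>, and the error of their derivative is
  u' (\<eta> - 1) + u \<eta>'. Both terms are bounded uniformly in \<open>n\<close> and tend to 0
  pointwise, so dominated convergence on the bounded interval applies.\<close>

lemma smooth_vanishing_in_H1_0:
  fixes u :: "real \<Rightarrow> real"
  assumes ab: "\<alpha> < \<beta>" and u: "smooth_on UNIV u" and u0: "u \<alpha> = 0" "u \<beta> = 0"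
  shows "u \<in> H1_0 {\<alpha><..<\<beta>}"
proof -
  define S where "S = {\<alpha><..<\<beta>}"
  have fin: "finite_measure (lebesgue_on S)"
    unfolding S_def by (intro finite_measure_lebesgue_on) simp
  interpret finite_measure "lebesgue_on S" by (rule fin)
  have S: "S \<in> sets lebesgue" by (simp add: S_def)
  have spc: "space (lebesgue_on S) = S" by (simp add: S_def)
  have meas: "f \<in> borel_measurable (lebesgue_on S)" if "smooth_on UNIV f" for f
    using continuous_imp_measurable_on_sets_lebesgue[OF smooth_continuous_on[OF that] S] .
  \<comment> \<open>The closed interval provides compactness, and the mean value estimates below
    start at its end points.\<close>
  have bd: "\<exists>B. \<forall>x\<in>{\<alpha>..\<beta>}. \<bar>f x\<bar> \<le> B" if "smooth_on UNIV f" for f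
    using compact_continuous_image[OF smooth_continuous_on[OF that] compact_Icc, of \<alpha> \<beta>]
    by (auto dest!: compact_imp_bounded simp: bounded_iff)
  have integ: "integrable (lebesgue_on S) f" if f: "smooth_on UNIV f" for f
  proof -
    obtain B where "\<forall>x\<in>{\<alpha>..\<beta>}. \<bar>f x\<bar> \<le> B" using bd[OF f] by blast
    then show ?thesis
      by (intro integrable_const_bound[where B = B] meas[OF f] AE_I2) (auto simp: S_def)
  qed
  have L2: "f \<in> L2_on S" if f: "smooth_on UNIV f" for f
    using meas[OF f] integ[OF smooth_mult[OF f f]] by (simp add: L2_on_def power2_eq_square)
  have du: "smooth_on UNIV (deriv u)" by (rule smooth_on_deriv[OF u])

  \<comment> \<open>Integration by parts: the classical derivative is a weak derivative\<close>
  have weak: "weak_deriv_on S u (deriv u)"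
    unfolding weak_deriv_on_def
  proof
    fix \<phi> assume "\<phi> \<in> test_functions S"
    then have \<phi>: "smooth_on UNIV \<phi>" by (auto simp: test_functions_def)
    note d\<phi> = smooth_on_deriv[OF \<phi>]
    let ?h = "\<lambda>x. u x * deriv \<phi> x + deriv u x * \<phi> x"
    have h: "integrable (lebesgue_on S) (\<lambda>x. u x * deriv \<phi> x)"
      "integrable (lebesgue_on S) (\<lambda>x. deriv u x * \<phi> x)"
      by (rule integ[OF smooth_mult[OF u d\<phi>]], rule integ[OF smooth_mult[OF du \<phi>]])
    \<comment> \<open>The boundary terms vanish because \<open>u\<close> is zero at both end
      points.\<close>
    have "(?h has_integral u \<beta> * \<phi> \<beta> - u \<alpha> * \<phi> \<alpha>) {\<alpha>..\<beta>}"
    proof (rule fundamental_theorem_of_calculus[where f = "\<lambda>x. u x * \<phi> x"])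
      fix x
      have "((\<lambda>x. u x * \<phi> x) has_real_derivative ?h x) (at x)"
        using DERIV_mult[OF smooth_on_DERIV[OF u UNIV_I] smooth_on_DERIV[OF \<phi> UNIV_I], of x]
        by (simp add: add.commute mult.commute)
      then show "((\<lambda>x. u x * \<phi> x) has_vector_derivative ?h x) (at x within {\<alpha>..\<beta>})"
        unfolding has_real_derivative_iff_has_vector_derivative
        by (rule has_vector_derivative_at_within)
    qed (use ab in simp)
    then have "integral S ?h = 0"
      using u0 unfolding S_def has_integral_Icc_iff_Ioo
      by (intro integral_unique) simp
    then have "(\<integral>x. ?h x \<partial>lebesgue_on S) = 0"
      using h by (subst lebesgue_integral_eq_integral[OF _ S]) auto
    then show "(\<integral>x. u x * deriv \<phi> x \<partial>lebesgue_on S) = - (\<integral>x. deriv u x * \<phi> x \<partial>lebesgue_on S)"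
      using h by simp
  qed

  \<comment> \<open>Cut-off approximants\<close>
  obtain M where M: "\<And>x. x \<in> {\<alpha>..\<beta>} \<Longrightarrow> \<bar>deriv u x\<bar> \<le> M" using bd[OF du] by blast
  obtain N where N: "\<And>x. x \<in> {\<alpha>..\<beta>} \<Longrightarrow> \<bar>u x\<bar> \<le> N" using bd[OF u] by blast
  have M0: "M \<ge> 0" using M[of \<alpha>] ab by auto

  \<comment> \<open>\<open>l\<close> and \<open>r\<close> are the distances to the two end points in
    units of \<open>1 / real (Suc n)\<close>. The shift by 1 in \<eta> makes it vanish within one
    unit of either end, while \<eta> tends to 1 inside.\<close>
  define l where "l n x = real (Suc n) * (x - \<alpha>)" for n x
  define r where "r n x = real (Suc n) * (\<beta> - x)" for n x
  define \<eta> where "\<eta> n x = flat 0 (l n x - 1) * flat 0 (r n x - 1)" for n x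
  define \<phi> where "\<phi> n x = u x * \<eta> n x" for n x
  \<comment> \<open>u \<eta>' is \<open>P - Q\<close>: the contributions of the left and the right
    cut-off, the latter negative because \<open>r\<close> decreases in \<open>x\<close>.\<close>
  define P where "P n x = u x * real (Suc n) * flat 2 (l n x - 1) * flat 0 (r n x - 1)" for n x
  define Q where "Q n x = u x * real (Suc n) * flat 2 (r n x - 1) * flat 0 (l n x - 1)" for n x

  have \<phi>_smooth: "smooth_on UNIV (\<phi> n)" for n
  proof -
    have "smooth_on UNIV (\<lambda>x. flat 0 (l n x - 1))"
      using smooth_compose[OF smooth_flat smooth_affine, of 0 "real (Suc n)" "- real (Suc n) * \<alpha> - 1"]
      by (simp add: l_def algebra_simps)
    moreover have "smooth_on UNIV (\<lambda>x. flat 0 (r n x - 1))"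
      using smooth_compose[OF smooth_flat smooth_affine, of 0 "- real (Suc n)" "real (Suc n) * \<beta> - 1"]
      by (simp add: r_def algebra_simps)
    ultimately show ?thesis
      unfolding \<phi>_def \<eta>_def by (intro smooth_mult u)
  qed
  have \<phi>_test: "\<phi> n \<in> test_functions S" for n
  proof -
    \<comment> \<open>May be empty for small \<open>n\<close>; then \<open>\<phi> n\<close> is
      identically zero and still a test function.\<close>
    let ?K = "{\<alpha> + 1 / real (Suc n)..\<beta> - 1 / real (Suc n)}"
    have "\<phi> n x = 0" if "x \<notin> ?K" for x
    proof -
      have "l n x < 1 \<or> r n x < 1"
        using that by (auto simp: l_def r_def field_simps)
      then show ?thesis by (auto simp: \<phi>_def \<eta>_def flat_def)
    qed
    moreover have "0 < 1 / real (Suc n)" by simp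
    then have "?K \<subseteq> S" unfolding S_def subset_iff atLeastAtMost_iff greaterThanLessThan_iff
      by (intro allI impI) linarith
    ultimately show ?thesis
      using \<phi>_smooth unfolding test_functions_def by (blast intro: compact_Icc)
  qed
  have d\<phi>: "deriv (\<phi> n) x - deriv u x = deriv u x * (\<eta> n x - 1) + P n x - Q n x" for n x
  proof -
    have dl: "((\<lambda>x. flat 0 (l n x - 1)) has_real_derivative flat 2 (l n x - 1) * real (Suc n)) (at x)"
      by (rule DERIV_chain2[OF DERIV_flat_0]) (auto simp: l_def intro!: derivative_eq_intros)
    have dr: "((\<lambda>x. flat 0 (r n x - 1)) has_real_derivative flat 2 (r n x - 1) * - real (Suc n)) (at x)"
      by (rule DERIV_chain2[OF DERIV_flat_0]) (auto simp: r_def intro!: derivative_eq_intros)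
    have "(\<phi> n has_real_derivative deriv u x * \<eta> n x + P n x - Q n x) (at x)"
      unfolding \<phi>_def \<eta>_def P_def Q_def
      by (rule derivative_eq_intros dl dr smooth_on_DERIV[OF u] UNIV_I refl)+
        (simp add: algebra_simps)
    from DERIV_imp_deriv[OF this] show ?thesis by (simp add: algebra_simps)
  qed

  \<comment> \<open>Uniform bounds and pointwise limits\<close>
  have \<eta>01: "0 \<le> \<eta> n x" "\<eta> n x \<le> 1" for n x
    by (auto simp: \<eta>_def flat_nonneg flat_0_le_1 mult_le_one)
  \<comment> \<open>The vanishing of \<open>u\<close> at the end point compensates the factor \<open>n\<close>.\<close>
  have P_le: "\<bar>P n x\<bar> \<le> M * \<bar>l n x * flat 2 (l n x - 1)\<bar>" if "x \<in> S" for n x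
  proof -
    have "\<bar>u x\<bar> \<le> M * \<bar>x - \<alpha>\<bar>"
      using that ab u0 by (intro vanishing_linear_bound[OF u _ _ _ M]) (auto simp: S_def)
    then have "\<bar>u x\<bar> * real (Suc n) * flat 2 (l n x - 1) * flat 0 (r n x - 1)
        \<le> (M * \<bar>x - \<alpha>\<bar>) * real (Suc n) * flat 2 (l n x - 1) * 1"
      using M0 by (intro mult_mono) (auto simp: flat_nonneg flat_0_le_1)
    also have "\<dots> = M * \<bar>l n x * flat 2 (l n x - 1)\<bar>"
      by (simp add: l_def abs_mult flat_nonneg mult_ac)
    finally show ?thesis
      by (simp add: P_def abs_mult flat_nonneg)
  qed
  have Q_le: "\<bar>Q n x\<bar> \<le> M * \<bar>r n x * flat 2 (r n x - 1)\<bar>" if "x \<in> S" for n x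
  proof -
    have "\<bar>u x\<bar> \<le> M * \<bar>x - \<beta>\<bar>"
      using that ab u0 by (intro vanishing_linear_bound[OF u _ _ _ M]) (auto simp: S_def)
    then have "\<bar>u x\<bar> * real (Suc n) * flat 2 (r n x - 1) * flat 0 (l n x - 1)
        \<le> (M * \<bar>x - \<beta>\<bar>) * real (Suc n) * flat 2 (r n x - 1) * 1"
      using M0 by (intro mult_mono) (auto simp: flat_nonneg flat_0_le_1)
    also have "\<dots> = M * \<bar>r n x * flat 2 (r n x - 1)\<bar>"
      by (simp add: r_def abs_mult flat_nonneg mult_ac abs_minus_commute)
    finally show ?thesis
      by (simp add: Q_def abs_mult flat_nonneg)
  qed
  have l_lim: "filterlim (\<lambda>n. l n x) at_top sequentially"
    and r_lim: "filterlim (\<lambda>n. r n x) at_top sequentially" if "x \<in> S" for x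
    using that unfolding l_def r_def S_def
    by (auto intro!: filterlim_at_top_mult_tendsto_pos[OF tendsto_const]
        filterlim_compose[OF filterlim_real_sequentially filterlim_Suc] simp del: of_nat_Suc)
  have \<eta>_lim: "(\<lambda>n. \<eta> n x) \<longlonglongrightarrow> 1" if "x \<in> S" for x
  proof -
    have "filterlim (\<lambda>t::real. t - 1) at_top at_top" by real_asymp
    then have "((\<lambda>t. flat 0 (t - 1)) \<longlongrightarrow> 1) at_top"
      by (rule filterlim_compose[OF flat_0_tendsto])
    from tendsto_mult[OF filterlim_compose[OF this l_lim[OF that]]
        filterlim_compose[OF this r_lim[OF that]]]
    show ?thesis by (simp add: \<eta>_def)
  qed
  have P_lim: "(\<lambda>n. P n x) \<longlonglongrightarrow> 0" if "x \<in> S" for x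
  proof (rule Lim_null_comparison)
    show "(\<lambda>n. M * \<bar>l n x * flat 2 (l n x - 1)\<bar>) \<longlonglongrightarrow> 0"
      using filterlim_compose[OF flat_2_weighted_tendsto l_lim[OF that]]
      by (intro tendsto_mult_right_zero tendsto_rabs_zero)
  qed (use P_le[OF that] in simp)
  have Q_lim: "(\<lambda>n. Q n x) \<longlonglongrightarrow> 0" if "x \<in> S" for x
  proof (rule Lim_null_comparison)
    show "(\<lambda>n. M * \<bar>r n x * flat 2 (r n x - 1)\<bar>) \<longlonglongrightarrow> 0"
      using filterlim_compose[OF flat_2_weighted_tendsto r_lim[OF that]]
      by (intro tendsto_mult_right_zero tendsto_rabs_zero)
  qed (use Q_le[OF that] in simp)

  \<comment> \<open>Convergence in the H1 norm\<close>
  have "(\<lambda>n. \<integral>x. (\<phi> n x - u x)\<^sup>2 \<partial>lebesgue_on S) \<longlonglongrightarrow> 0"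
  proof (rule bounded_integrals_tendsto_0[OF fin, where C = N])
    show "(\<lambda>x. \<phi> n x - u x) \<in> borel_measurable (lebesgue_on S)" for n
      by (intro borel_measurable_diff meas \<phi>_smooth u)
    fix x assume "x \<in> space (lebesgue_on S)"
    then have x: "x \<in> S" by (simp only: spc)
    have "\<bar>u x\<bar> * \<bar>\<eta> n x - 1\<bar> \<le> N * 1" for n
      using N[of x] x \<eta>01[of n x] by (intro mult_mono) (auto simp: S_def)
    then show "\<bar>\<phi> n x - u x\<bar> \<le> N" for n
      by (simp add: \<phi>_def right_diff_distrib flip: abs_mult)
    show "(\<lambda>n. \<phi> n x - u x) \<longlonglongrightarrow> 0"
      unfolding \<phi>_def by (rule tendsto_eq_intros \<eta>_lim[OF x] refl)+ simp
  qed
  moreover have "(\<lambda>n. \<integral>x. (deriv (\<phi> n) x - deriv u x)\<^sup>2 \<partial>lebesgue_on S) \<longlonglongrightarrow> 0"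
  \<comment> \<open>7 = 1 + 3 + 3: the term u' (\<eta> - 1) contributes \<open>M\<close>, and each
    of \<open>P\<close> and \<open>Q\<close> contributes \<open>3 * M\<close>.\<close>
  proof (rule bounded_integrals_tendsto_0[OF fin, where C = "7 * M"])
    show "(\<lambda>x. deriv (\<phi> n) x - deriv u x) \<in> borel_measurable (lebesgue_on S)" for n
      by (intro borel_measurable_diff meas smooth_on_deriv \<phi>_smooth u)
    fix x assume "x \<in> space (lebesgue_on S)"
    then have x: "x \<in> S" by (simp only: spc)
    show "\<bar>deriv (\<phi> n) x - deriv u x\<bar> \<le> 7 * M" for n
    proof -
      have "\<bar>deriv u x * (\<eta> n x - 1)\<bar> \<le> M * 1"
        unfolding abs_mult using M[of x] x \<eta>01[of n x] M0
        by (intro mult_mono) (auto simp: S_def)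
      moreover have "\<bar>P n x\<bar> \<le> M * 3"
        using P_le[OF x, of n] mult_left_mono[OF flat_2_weighted_bound M0] by (rule order_trans)
      moreover have "\<bar>Q n x\<bar> \<le> M * 3"
        using Q_le[OF x, of n] mult_left_mono[OF flat_2_weighted_bound M0] by (rule order_trans)
      ultimately show ?thesis unfolding d\<phi> by linarith
    qed
    show "(\<lambda>n. deriv (\<phi> n) x - deriv u x) \<longlonglongrightarrow> 0"
      unfolding d\<phi> by (rule tendsto_eq_intros \<eta>_lim[OF x] P_lim[OF x] Q_lim[OF x] refl)+ simp
  qed
  ultimately have "(\<lambda>n. (\<integral>x. (\<phi> n x - u x)\<^sup>2 \<partial>lebesgue_on S)
      + (\<integral>x. (deriv (\<phi> n) x - deriv u x)\<^sup>2 \<partial>lebesgue_on S)) \<longlonglongrightarrow> 0 + 0"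
    by (rule tendsto_add)
  then have "u \<in> H1_0 S"
    using L2[OF u] L2[OF du] weak \<phi>_test unfolding H1_0_def by auto
  then show ?thesis by (simp only: S_def)
qed

section \<open>The metric\<close>

text \<open>For c = s'^2 with s' > 0 the factor sqrt(c)/c is 1/s', so the flux of -sin(s) is
  -cos(s). Its derivative is sin(s) s', and dividing by sqrt(c) = s' leaves sin(s).\<close>

lemma laplace_beltrami_arc_length:
  fixes s :: "real \<Rightarrow> real"
  assumes S: "open S" "x \<in> S" and s: "smooth_on UNIV s" and pos: "\<And>y. y \<in> S \<Longrightarrow> 0 < deriv s y"
  shows "laplace_beltrami (\<lambda>y. (deriv s y)\<^sup>2) (\<lambda>y. - sin (s y)) x = sin (s x)"
proof -
  have ds: "(s has_real_derivative deriv s y) (at y)" for y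
    using smooth_on_DERIV[OF s] by simp
  have du: "deriv (\<lambda>y. - sin (s y)) y = - cos (s y) * deriv s y" for y
    by (rule DERIV_imp_deriv) (auto intro!: derivative_eq_intros ds)
  have "((\<lambda>y. - cos (s y)) has_real_derivative sin (s x) * deriv s x) (at x)"
    by (auto intro!: derivative_eq_intros ds)
  \<comment> \<open>The flux equals -cos(s) only where s' > 0; openness of \<open>S\<close> suffices
    to transfer the derivative.\<close>
  then have "((\<lambda>y. sqrt ((deriv s y)\<^sup>2) * inverse ((deriv s y)\<^sup>2) * deriv (\<lambda>y. - sin (s y)) y)
      has_real_derivative sin (s x) * deriv s x) (at x)"
    by (rule has_field_derivative_transform_within_open[OF _ S])
      (use pos in \<open>force simp: du field_simps power2_eq_square\<close>)
  from DERIV_imp_deriv[OF this] show ?thesis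
    using pos[OF S(2)] by (simp add: laplace_beltrami_def)
qed

theorem theorem5p1:
  fixes a b :: real
  assumes "a < b"
    and "{a<..<b} \<subseteq> {0<..<pi}"
    and "a > pi / 2"
  shows "\<exists>c u\<^sub>1 u\<^sub>2 :: real \<Rightarrow> real.
           riemannian_metric_on {0<..<pi} c \<and>
           u\<^sub>1 \<in> H1_0 {0<..<pi} \<and> u\<^sub>2 \<in> H1_0 {0<..<pi} \<and>
           eigenfunction_on {0<..<pi} (\<lambda>u. deriv (deriv u)) 1 u\<^sub>1 \<and>
           eigenfunction_on {0<..<pi} (laplace_beltrami c) 1 u\<^sub>2 \<and>
           (\<forall>x\<in>{a<..<b}. u\<^sub>1 x + u\<^sub>2 x = 0) \<and>
           \<not> (\<forall>x\<in>{0<..<pi}. u\<^sub>1 x + u\<^sub>2 x = 0)"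
proof -
  let ?I = "{0<..<pi}"
  \<comment> \<open>The perturbation vanishes for x \<ge> pi/2, hence on ]a,b[; the factor
    \<open>x\<close> keeps s(0) = 0, and the factor 1/2 keeps the slope at least 1/2 on
    ]0,pi[.\<close>
  define s where "s x = x - x / 2 * flat 0 (pi / 2 - x)" for x
  define c where "c x = (deriv s x)\<^sup>2" for x
  define v where "v x = - sin (s x)" for x

  have "smooth_on UNIV (\<lambda>x. (1 * x + 0) + (- (1 / 2) * x + 0) * flat 0 ((-1) * x + pi / 2))"
    by (intro smooth_add smooth_mult smooth_affine smooth_compose[OF smooth_flat])
  then have s_smooth: "smooth_on UNIV s"
    by (simp add: s_def[abs_def])
  have "smooth_on UNIV (\<lambda>x. (-1) * sin (s x))"
    by (intro smooth_mult smooth_const smooth_compose[OF smooth_sin] s_smooth)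
  then have v_smooth: "smooth_on UNIV v" by (simp add: v_def[abs_def])
  have c_smooth: "smooth_on UNIV c"
    unfolding c_def power2_eq_square by (intro smooth_mult smooth_on_deriv s_smooth)

  \<comment> \<open>Properties of the coordinate change\<close>
  have ds: "deriv s x = 1 - flat 0 (pi / 2 - x) / 2 + x / 2 * flat 2 (pi / 2 - x)" for x
  proof -
    have "((\<lambda>x. flat 0 (pi / 2 - x)) has_real_derivative flat 2 (pi / 2 - x) * (-1)) (at x)"
      by (rule DERIV_chain2[OF DERIV_flat_0]) (auto intro!: derivative_eq_intros)
    then have "(s has_real_derivative
        1 - flat 0 (pi / 2 - x) / 2 + x / 2 * flat 2 (pi / 2 - x)) (at x)"
      unfolding s_def by (auto intro!: derivative_eq_intros simp: field_simps)
    then show ?thesis by (rule DERIV_imp_deriv)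
  qed
  have ds_pos: "0 < deriv s x" if "x \<in> ?I" for x
  proof -
    \<comment> \<open>The reflected cut-off decreases and is subtracted, so for x > 0 its slope
      helps monotonicity.\<close>
    have "0 \<le> x / 2 * flat 2 (pi / 2 - x)" using that flat_nonneg by auto
    then show ?thesis unfolding ds using flat_0_le_1[of "pi / 2 - x"] by linarith
  qed
  have s_id: "s x = x" if "x \<ge> pi / 2" for x
    using that by (simp add: s_def flat_def)
  \<comment> \<open>pi/4 is a point where \<open>s\<close> moves its argument; both values lie where
    sin is strictly increasing, so the two eigenfunctions do not cancel there.\<close>
  have s_lt: "0 < s (pi / 4)" "s (pi / 4) < pi / 4"
  proof -
    have f: "0 < flat 0 (pi / 4)" "flat 0 (pi / 4) \<le> 1"
      by (simp_all add: flat_def)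
    have s: "s (pi / 4) = pi / 4 * (1 - flat 0 (pi / 4) / 2)"
      by (simp add: s_def algebra_simps)
    show "0 < s (pi / 4)"
      unfolding s using f by (intro mult_pos_pos) auto
    have "pi / 4 * (1 - flat 0 (pi / 4) / 2) < pi / 4 * 1"
      using f by (intro mult_strict_left_mono) auto
    then show "s (pi / 4) < pi / 4" by (simp add: s)
  qed

  \<comment> \<open>The metric and the two eigenfunctions\<close>
  have metric: "riemannian_metric_on ?I c"
    using ds_pos smooth_on_subset[OF c_smooth, of ?I]
    by (force simp: riemannian_metric_on_def c_def)
  have H1: "sin \<in> H1_0 ?I"
    by (rule smooth_vanishing_in_H1_0[OF pi_gt_zero smooth_sin]) auto
  \<comment> \<open>The boundary values vanish since \<open>s\<close> fixes 0 and pi.\<close>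
  have H2: "v \<in> H1_0 ?I"
    by (rule smooth_vanishing_in_H1_0[OF pi_gt_zero v_smooth]) (auto simp: v_def s_def flat_def)
  have "deriv (deriv sin) x = - sin x" for x :: real
  proof -
    have "deriv sin = (cos :: real \<Rightarrow> real)" by (auto intro!: ext DERIV_imp_deriv)
    then show ?thesis by (simp add: DERIV_imp_deriv[OF DERIV_cos])
  qed
  then have E1: "eigenfunction_on ?I (\<lambda>u. deriv (deriv u)) 1 sin"
    using smooth_on_subset[OF smooth_sin, of ?I]
    by (auto simp: eigenfunction_on_def intro!: bexI[of _ "pi / 2"])
  have "laplace_beltrami c v x = - v x" if "x \<in> ?I" for x
    using laplace_beltrami_arc_length[OF _ that s_smooth ds_pos]
    by (simp add: c_def[abs_def] v_def[abs_def])
  \<comment> \<open>Nontriviality is seen at pi/2, which \<open>s\<close> fixes, so that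
    \<open>v\<close> is -1 there.\<close>
  then have E2: "eigenfunction_on ?I (laplace_beltrami c) 1 v"
    using smooth_on_subset[OF v_smooth, of ?I]
    by (auto simp: eigenfunction_on_def v_def s_id intro!: bexI[of _ "pi / 2"])
  have eq: "\<forall>x\<in>{a<..<b}. sin x + v x = 0"
    using assms by (auto simp: v_def s_id)
  have "sin (s (pi / 4)) < sin (pi / 4)"
    using s_lt by (intro sin_monotone_2pi) auto
  then have "sin (pi / 4) + v (pi / 4) \<noteq> 0" by (simp add: v_def)
  then have "\<not> (\<forall>x\<in>?I. sin x + v x = 0)"
    by (force intro!: bexI[of _ "pi / 4"])
  with metric H1 H2 E1 E2 eq show ?thesis by blast
qed

end
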